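(* Let $\mathbb{F}\in\{\mathbb{R},\mathbb{C}\}$, $d\ge2$, $n\ge 1$, let $a_{k,j}\in\mathbb{F}$ ($2\le k\le n$, $2\le j\le d$), and let $L_0,\dots,L_n$ be defined by $L_0=1$, $L_1=x_1$ and, for $2\le k\le n$, $$L_k=\Psi_1(M_1)+\sum_{j=2}^d\Psi_j\big((M_j)_{i_1=\dots=i_{j-1}=0}\big)+a_{k,2}x_2+\dots+a_{k,d}x_d,\quad M_1=L_{k-1},\ M_j=\sum_{t=2}^{k-1}a_{t,j}L_{k-t}.$$ Let $\mathbf{z}_0\in\mathbb{F}^d$ and for $i=0,\dots,n$ define $$\mathbf{z}_i(h)=\mathbf{z}_0+\Big(ih,\ \sum_{j=2}^n a_{j,2}(ih)^j,\ \dots,\ \sum_{j=2}^n a_{j,d}(ih)^j\Big).$$ For $m\ge0$ and $0\le k\le m$ let $A^{(m)}_k=(-1)^{m-k}\frac{1}{k!(m-k)!}$. Then for every function $f$ analytic at $\mathbf{z}_0$ and every $m=0,\dots,n$, $$(L_m(D)f)(\mathbf{z}_0)=\lim_{h\to0}\frac{1}{h^m}\sum_{r=0}^mA^{(m)}_r f(\mathbf{z}_r(h)).$$ In other words, $\mathrm{span}\{\delta_{\mathbf{z}_0}\circ L_0(D),\dots,\delta_{\mathbf{z}_0}\circ L_n(D)\}=\lim_{h\to0}\mathrm{span}\{\delta_{\mathbf{z}_i(h)}:i=0,\dots,n\}$.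
   Context: $\Psi_j$ is the linear operator on polynomials with $\Psi_j(x_1^{\alpha_1}\cdots x_d^{\alpha_d})=\frac{1}{\alpha_j+1}x_1^{\alpha_1}\cdots x_j^{\alpha_j+1}\cdots x_d^{\alpha_d}$; $(M)_{i_1=\dots=i_{j-1}=0}$ is the sum of the terms of $M$ containing none of $x_1,\dots,x_{j-1}$. For $p=\sum_\alpha c_\alpha\mathbf{x}^\alpha$, $p(D)=\sum_\alpha c_\alpha\,\partial^{|\alpha|}/\partial x_1^{\alpha_1}\cdots\partial x_d^{\alpha_d}$. $\delta_{\mathbf z}$ denotes evaluation at $\mathbf z$; the limit of spans is understood in the sense of the preceding pointwise limit formula. *)

theory Defs
  imports "HOL-Analysis.Analysis"
begin

text \<open>Conventions. The variables x_1,...,x_d are indexed 0,...,d-1 (x_j is index j-1).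
Points of F^d are functions nat => F vanishing at indices >= d.
Multi-indices are functions nat => nat (vanishing at indices >= d).
A polynomial is its coefficient function (nat => nat) => F (finite support).\<close>

type_synonym 'a mpoly = "(nat \<Rightarrow> nat) \<Rightarrow> 'a"

definition unitidx :: "nat \<Rightarrow> nat \<Rightarrow> nat" where
  "unitidx i = (\<lambda>k. if k = i then 1 else 0)"

definition mp_one :: "'a::zero_neq_one mpoly" where
  "mp_one = (\<lambda>\<beta>. if \<beta> = (\<lambda>_. 0) then 1 else 0)"

definition mp_var :: "nat \<Rightarrow> 'a::zero_neq_one mpoly" where
  "mp_var i = (\<lambda>\<beta>. if \<beta> = unitidx i then 1 else 0)"

text \<open>Psi_(i+1): maps x^alpha to x^(alpha + e_i) / (alpha_i + 1).\<close>
definition Psi :: "nat \<Rightarrow> 'a::field_char_0 mpoly \<Rightarrow> 'a mpoly" where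
  "Psi i p = (\<lambda>\<beta>. if 1 \<le> \<beta> i then p (\<beta>(i := \<beta> i - 1)) / of_nat (\<beta> i) else 0)"

definition restr :: "nat \<Rightarrow> 'a::zero mpoly \<Rightarrow> 'a mpoly" where
  "restr i p = (\<lambda>\<beta>. if (\<forall>k<i. \<beta> k = 0) then p \<beta> else 0)"

text \<open>The polynomials L_k (a k j = a_{k,j} with paper indices).\<close>
function Lpoly :: "(nat \<Rightarrow> nat \<Rightarrow> 'a::field_char_0) \<Rightarrow> nat \<Rightarrow> nat \<Rightarrow> 'a mpoly" where
  "Lpoly a d k =
    (if k = 0 then mp_one
     else if k = 1 then mp_var 0
     else (\<lambda>\<beta>. Psi 0 (Lpoly a d (k - 1)) \<beta>
       + (\<Sum>j=2..d. Psi (j - 1)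
            (restr (j - 1) (\<lambda>\<gamma>. \<Sum>t=2..k - 1. a t j * Lpoly a d (k - t) \<gamma>)) \<beta>)
       + (\<Sum>j=2..d. a k j * mp_var (j - 1) \<beta>)))"
  by pat_completeness auto
termination
  by (relation "Wellfounded.measure (\<lambda>(a, d, k). k)") auto

definition pdiff :: "nat \<Rightarrow> ((nat \<Rightarrow> 'a::real_normed_field) \<Rightarrow> 'a) \<Rightarrow> (nat \<Rightarrow> 'a) \<Rightarrow> 'a" where
  "pdiff i g = (\<lambda>z. deriv (\<lambda>t. g (z(i := z i + t))) 0)"

fun dpow :: "nat \<Rightarrow> (nat \<Rightarrow> nat) \<Rightarrow> ((nat \<Rightarrow> 'a::real_normed_field) \<Rightarrow> 'a) \<Rightarrow> (nat \<Rightarrow> 'a) \<Rightarrow> 'a" where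
  "dpow 0 \<alpha> g = g"
| "dpow (Suc k) \<alpha> g = (pdiff k ^^ \<alpha> k) (dpow k \<alpha> g)"

definition partial :: "nat \<Rightarrow> (nat \<Rightarrow> nat) \<Rightarrow> ((nat \<Rightarrow> 'a::real_normed_field) \<Rightarrow> 'a) \<Rightarrow> (nat \<Rightarrow> 'a) \<Rightarrow> 'a" where
  "partial d \<alpha> f = dpow d \<alpha> f"

definition polyD :: "nat \<Rightarrow> 'a::real_normed_field mpoly \<Rightarrow> ((nat \<Rightarrow> 'a) \<Rightarrow> 'a) \<Rightarrow> (nat \<Rightarrow> 'a) \<Rightarrow> 'a" where
  "polyD d p f z = (\<Sum>\<alpha> | p \<alpha> \<noteq> 0. p \<alpha> * partial d \<alpha> f z)"

definition analytic_pt :: "nat \<Rightarrow> ((nat \<Rightarrow> 'a::{real_normed_field,banach}) \<Rightarrow> 'a) \<Rightarrow> (nat \<Rightarrow> 'a) \<Rightarrow> bool" where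
  "analytic_pt d f z0 \<longleftrightarrow> (\<exists>r>0. \<exists>c :: (nat \<Rightarrow> nat) \<Rightarrow> 'a.
     \<forall>z. (\<forall>i\<ge>d. z i = 0) \<and> (\<forall>i<d. norm (z i - z0 i) < r) \<longrightarrow>
       ((\<lambda>\<alpha>. c \<alpha> * (\<Prod>i<d. (z i - z0 i) ^ \<alpha> i)) has_sum f z) {\<alpha>. \<forall>i\<ge>d. \<alpha> i = 0})"

definition znode :: "nat \<Rightarrow> nat \<Rightarrow> (nat \<Rightarrow> nat \<Rightarrow> 'a::field) \<Rightarrow> (nat \<Rightarrow> 'a) \<Rightarrow> nat \<Rightarrow> 'a \<Rightarrow> nat \<Rightarrow> 'a" where
  "znode d n a z0 i h = (\<lambda>c. if c = 0 then z0 0 + of_nat i * h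
      else if c < d then z0 c + (\<Sum>j=2..n. a j (c + 1) * (of_nat i * h) ^ j)
      else z0 c)"

definition Acoef :: "nat \<Rightarrow> nat \<Rightarrow> 'a::field_char_0" where
  "Acoef m k = (-1) ^ (m - k) / (fact k * fact (m - k))"

end

theory Submission
  imports Defs
begin

text \<open>Let \<open>\<gamma>(t) = (t, \<Sum>\<^sub>j a\<^sub>j\<^sub>,\<^sub>2 t\<^sup>j, \<dots>)\<close>. The recursion for the \<open>L\<^sub>k\<close> integrates the identities
  \<open>\<partial>\<^sub>i G = \<gamma>\<^sub>i G\<close> for the generating function \<open>G = exp (\<Sum>\<^sub>i \<gamma>\<^sub>i(t) x\<^sub>i)\<close>, so \<open>L\<^sub>m\<close> is the coefficient of
  \<open>t\<^sup>m\<close> in \<open>G\<close> and \<open>(L\<^sub>m(D) f)(z\<^sub>0)\<close> is the coefficient of \<open>t\<^sup>m\<close> in \<open>g(t) = f(z\<^sub>0 + \<gamma>(t))\<close>. The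
  nodes lie on this curve, and the scaled sums are the \<open>m\<close>-th divided differences of \<open>g\<close> at
  \<open>0, h, \<dots>, m h\<close>.\<close>

declare Lpoly.simps [simp del]

section \<open>Moments of the divided-difference weights\<close>

text \<open>The \<open>Acoef m r\<close> are the weights of the divided difference at
  \<open>0, ..., m\<close>, so they annihilate powers below \<open>m\<close> and send the
  \<open>m\<close>-th power to 1. The induction absorbs one factor by
  \<open>(r + 1) * Acoef (m + 1) (r + 1) = Acoef m r\<close>; exponent 0 is the expansion of
  \<open>(1 - 1) ^ (m + 1)\<close>.\<close>

lemma sum_Acoef_power:
  assumes "k \<le> m"
  shows "(\<Sum>r=0..m. Acoef m r * of_nat r ^ k) = (if k = m then 1 else (0 :: 'a :: field_char_0))"
  using assms
proof (induction m arbitrary: k)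
  case 0
  then show ?case by (simp add: Acoef_def)
next
  case (Suc m)
  show ?case
  proof (cases k)
    case 0
    have "(\<Sum>r=0..Suc m. Acoef (Suc m) r)
        = (\<Sum>r\<le>Suc m. of_nat (Suc m choose r) * (-1) ^ (Suc m - r)) / (fact (Suc m) :: 'a)"
      unfolding sum_divide_distrib atMost_atLeast0
      by (intro sum.cong) (simp_all add: Acoef_def binomial_fact del: fact_Suc)
    also have "(\<Sum>r\<le>Suc m. of_nat (Suc m choose r) * (-1) ^ (Suc m - r)) = (0 :: 'a)"
      using binomial_ring[of "1 :: 'a" "-1" "Suc m"] by simp
    finally show ?thesis using 0 by simp
  next
    case (Suc l)
    have l: "l \<le> m" using Suc.prems Suc by simp
    have step: "Acoef (Suc m) (Suc r) * of_nat (Suc r) ^ k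
        = (\<Sum>i\<le>l. of_nat (l choose i) * (Acoef m r * (of_nat r :: 'a) ^ i))" for r
    proof -
      have "of_nat (Suc r) * Acoef (Suc m) (Suc r) = (Acoef m r :: 'a)"
        by (simp add: Acoef_def field_simps del: of_nat_Suc)
      moreover have "of_nat (Suc r) ^ l = (\<Sum>i\<le>l. of_nat (l choose i) * (of_nat r :: 'a) ^ i)"
        using binomial_ring[of "of_nat r :: 'a" 1 l] by (simp add: add.commute)
      moreover have "Acoef (Suc m) (Suc r) * of_nat (Suc r) ^ k
          = (of_nat (Suc r) * Acoef (Suc m) (Suc r)) * (of_nat (Suc r) :: 'a) ^ l"
        by (simp add: Suc mult_ac)
      ultimately show ?thesis
        by (simp add: sum_distrib_left mult_ac del: of_nat_Suc)
    qed
    have "(\<Sum>r=0..Suc m. Acoef (Suc m) r * (of_nat r :: 'a) ^ k)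
        = (\<Sum>r=0..m. Acoef (Suc m) (Suc r) * of_nat (Suc r) ^ k)"
      by (subst sum.atLeast0_atMost_Suc_shift) (simp add: Suc)
    also have "\<dots> = (\<Sum>i\<le>l. of_nat (l choose i) * (\<Sum>r=0..m. Acoef m r * (of_nat r :: 'a) ^ i))"
      unfolding step sum_distrib_left by (rule sum.swap)
    also have "\<dots> = (\<Sum>i\<le>l. if i = m then of_nat (l choose i) else 0)"
      using l by (intro sum.cong) (simp_all add: Suc.IH)
    also have "\<dots> = (if k = Suc m then 1 else 0)"
      using l Suc by auto
    finally show ?thesis .
  qed
qed

section \<open>The curve and monomials along it\<close>

text \<open>The base point is left out, so the curve starts at the origin. The shift
  \<open>i + 1\<close> is there because the second index of \<open>a\<close> counts the variables
  from 1.\<close>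

definition curve :: "nat \<Rightarrow> (nat \<Rightarrow> nat \<Rightarrow> 'a::comm_ring_1) \<Rightarrow> nat \<Rightarrow> 'a poly" where
  "curve n a i = (if i = 0 then monom 1 1 else (\<Sum>j=2..n. monom (a j (i + 1)) j))"

text \<open>Divided by the factorials of the entries of \<beta>, this is the coefficient of the
  monomial with exponent \<beta> in the generating function \<open>G\<close>.\<close>

definition curve_monom :: "nat \<Rightarrow> nat \<Rightarrow> (nat \<Rightarrow> nat \<Rightarrow> 'a::comm_ring_1) \<Rightarrow> (nat \<Rightarrow> nat) \<Rightarrow> 'a poly" where
  "curve_monom d n a \<beta> = (\<Prod>i<d. curve n a i ^ \<beta> i)"

lemma coeff_curve:
  "coeff (curve n a i) t =
     (if i = 0 then (if t = 1 then 1 else 0) else if 2 \<le> t \<and> t \<le> n then a t (i + 1) else 0)"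
  by (auto simp: curve_def coeff_sum)

lemma coeff_eq_0_if_monom_dvd:
  fixes p :: "'a::idom poly"
  assumes "monom 1 s dvd p" "k < s"
  shows "coeff p k = 0"
  using assms by (auto simp: coeff_monom_mult elim!: dvdE)

lemma monom_dvd_curve: "monom 1 1 dvd (curve n a i :: 'a::idom poly)"
  by (simp add: monom_altdef coeff_curve poly_0_coeff_0 flip: poly_eq_0_iff_dvd[of _ 0, simplified])

text \<open>Each factor vanishes at \<open>t = 0\<close> and contributes a factor \<open>t\<close>.
  This is what bounds the total degree of \<open>Lpoly a d k\<close> by \<open>k\<close>.\<close>

lemma coeff_curve_monom_eq_0:
  fixes a :: "nat \<Rightarrow> nat \<Rightarrow> 'a::idom"
  assumes "k < (\<Sum>i<d. \<beta> i)"
  shows "coeff (curve_monom d n a \<beta>) k = 0"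
proof (rule coeff_eq_0_if_monom_dvd[OF _ assms])
  have "monom (1::'a) (\<Sum>i<d. \<beta> i) = (\<Prod>i<d. monom 1 1 ^ \<beta> i)"
    by (simp add: monom_altdef power_sum)
  also have "\<dots> dvd curve_monom d n a \<beta>"
    unfolding curve_monom_def by (intro prod_dvd_prod dvd_power_same monom_dvd_curve)
  finally show "monom 1 (\<Sum>i<d. \<beta> i) dvd curve_monom d n a \<beta>" .
qed

lemma curve_monom_split:
  assumes "i < d" "0 < \<beta> i"
  shows "curve_monom d n a \<beta> = curve n a i * curve_monom d n a (\<beta>(i := \<beta> i - 1))"
proof -
  have "curve_monom d n a \<beta> = curve n a i ^ \<beta> i * (\<Prod>j\<in>{..<d} - {i}. curve n a j ^ \<beta> j)"
    unfolding curve_monom_def using assms by (subst prod.remove[of _ i]) auto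
  moreover have "curve_monom d n a (\<beta>(i := \<beta> i - 1))
      = curve n a i ^ (\<beta> i - 1) * (\<Prod>j\<in>{..<d} - {i}. curve n a j ^ \<beta> j)"
    unfolding curve_monom_def using assms by (subst prod.remove[of _ i]) auto
  ultimately show ?thesis
    using assms by (simp add: power_eq_if)
qed

section \<open>The polynomials \<open>Lpoly\<close> as coefficients of the generating
  function\<close>

lemma Lpoly_0: "Lpoly a d 0 = mp_one"
  by (simp add: Lpoly.simps)

lemma Lpoly_1: "Lpoly a d (Suc 0) = mp_var 0"
  by (simp add: Lpoly.simps)

lemma Lpoly_at_0:
  assumes "0 < k"
  shows "Lpoly a d k (\<lambda>_. 0) = 0"
  using assms by (subst Lpoly.simps) (auto simp: mp_var_def unitidx_def Psi_def fun_eq_iff)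

text \<open>Lowering the entry at \<open>j\<close> leaves the nonzero entry at \<open>l < j\<close>
  in place, and \<open>restr j\<close> rejects it.\<close>

lemma Psi_restr_eq_0:
  assumes "l < j" "0 < \<beta> l"
  shows "Psi j (restr j q) \<beta> = 0"
proof -
  have "\<not> (\<forall>k<j. (\<beta>(j := \<beta> j - 1)) k = 0)"
    using assms by (intro notI, elim allE[of _ l]) simp
  then show ?thesis by (simp only: Psi_def restr_def if_False div_0 if_cancel)
qed

text \<open>Lets the linear terms of the recursion be read as multiples of \<open>mp_one\<close> at
  the lowered index, like the \<open>Psi\<close> terms.\<close>

lemma unitidx_iff:
  assumes "0 < \<beta> i"
  shows "\<beta> = unitidx i \<longleftrightarrow> \<beta>(i := \<beta> i - 1) = (\<lambda>_. 0)"
  using assms by (auto simp: unitidx_def fun_eq_iff split: if_splits)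

text \<open>Reading off the coefficient at an index whose least nonzero entry sits at \<open>i\<close>: all the
  summands \<open>Psi j\<close> with \<open>j \<noteq> i\<close> vanish there, which is what the restrictions are for.\<close>

lemma Lpoly_rec:
  fixes a :: "nat \<Rightarrow> nat \<Rightarrow> 'a::field_char_0"
  assumes "0 < k" "k \<le> n" "0 < \<beta> i" "\<And>j. j < i \<Longrightarrow> \<beta> j = 0" "0 < d"
  shows "Lpoly a d k \<beta> = (if i < d
     then (\<Sum>t\<le>k. coeff (curve n a i) t * Lpoly a d (k - t) (\<beta>(i := \<beta> i - 1))) / of_nat (\<beta> i)
     else 0)"
proof -
  let ?\<beta> = "\<beta>(i := \<beta> i - 1)"
  have unit: "mp_var i \<beta> = (mp_one ?\<beta> / of_nat (\<beta> i) :: 'a)"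
    using unitidx_iff[of \<beta> i] assms(3) by (auto simp: mp_var_def mp_one_def unitidx_def)
  have unit': "mp_var j \<beta> = (0::'a)" if "j \<noteq> i" for j
    using that assms(3) by (auto simp: mp_var_def unitidx_def)
  show ?thesis
  proof (cases "i = 0")
    case True
    \<comment> \<open>Component 0 of the curve is the parameter itself, so only the summand
      \<open>t = 1\<close> survives.\<close>
    have "(\<Sum>t\<le>k. coeff (curve n a i) t * Lpoly a d (k - t) ?\<beta>) = Lpoly a d (k - 1) ?\<beta>"
      using True assms(1) by (simp add: coeff_curve if_distrib[of "\<lambda>x. x * _"] cong: if_cong)
    moreover have "Lpoly a d k \<beta> = Lpoly a d (k - 1) ?\<beta> / of_nat (\<beta> 0)"
    proof (cases "k = 1")
      case True
      then show ?thesis using unit \<open>i = 0\<close> by (simp add: Lpoly_1 Lpoly_0 Lpoly_0)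
    next
      case False
      have "Psi (j - 1) (restr (j - 1) q) \<beta> = 0" "mp_var (j - 1) \<beta> = (0::'a)"
        if "2 \<le> j" for j and q :: "'a mpoly"
      proof -
        have "j - 1 \<noteq> i" using that True by simp
        then show "mp_var (j - 1) \<beta> = (0::'a)" by (rule unit')
        show "Psi (j - 1) (restr (j - 1) q) \<beta> = 0"
          using that True assms(3) by (intro Psi_restr_eq_0[of i]) auto
      qed
      then show ?thesis
        using False assms(1,3) True by (subst Lpoly.simps) (simp add: Psi_def)
    qed
    ultimately show ?thesis using True assms(5) by simp
  next
    case False
    have b0: "\<beta> 0 = 0" using False assms(4) by blast
    show ?thesis
    proof (cases "k = 1")
      case True
      then show ?thesis
        using False by (simp add: Lpoly_1 unit' coeff_curve)
    next
      case k: False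
      define M where "M j = (\<lambda>\<gamma>. \<Sum>t=2..k - 1. a t j * Lpoly a d (k - t) \<gamma>)" for j
      have eq: "Psi (j - 1) (restr (j - 1) (M j)) \<beta> + a k j * mp_var (j - 1) \<beta>
          = (if j = i + 1 then (M j ?\<beta> + a k j * mp_one ?\<beta>) / of_nat (\<beta> i) else 0)"
        if "2 \<le> j" for j
      proof (cases "j = i + 1")
        case True
        then show ?thesis
          using assms(3,4) unit by (simp add: Psi_def restr_def add_divide_distrib)
      next
        case neq: False
        then have neq': "j - 1 \<noteq> i" using that by simp
        have "Psi (j - 1) (restr (j - 1) (M j)) \<beta> = 0"
        proof (cases "j - 1 < i")
          case True
          then show ?thesis using assms(4) by (simp add: Psi_def)
        next
          case False
          then show ?thesis
            using neq' assms(3) by (intro Psi_restr_eq_0[of i]) auto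
        qed
        then show ?thesis using neq unit'[OF neq'] by simp
      qed
      have "Lpoly a d k \<beta>
          = (\<Sum>j=2..d. Psi (j - 1) (restr (j - 1) (M j)) \<beta> + a k j * mp_var (j - 1) \<beta>)"
        using k assms(1) b0 by (subst Lpoly.simps) (simp add: Psi_def[of 0] M_def sum.distrib)
      also have "\<dots> = (\<Sum>j=2..d. if j = i + 1
          then (M j ?\<beta> + a k j * mp_one ?\<beta>) / of_nat (\<beta> i) else 0)"
        by (intro sum.cong refl eq) simp
      also have "\<dots> = (if i < d then (M (i + 1) ?\<beta> + a k (i + 1) * mp_one ?\<beta>) / of_nat (\<beta> i) else 0)"
        using False by auto
      \<comment> \<open>Since \<open>Lpoly a d 0\<close> is \<open>mp_one\<close>, the linear term
        is the missing summand \<open>t = k\<close>.\<close>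
      also have "M (i + 1) ?\<beta> + a k (i + 1) * mp_one ?\<beta>
          = (\<Sum>t=2..k. a t (i + 1) * Lpoly a d (k - t) ?\<beta>)"
        using k assms(1) by (cases k) (auto simp: M_def Lpoly_0 le_Suc_eq)
      \<comment> \<open>The curve carries \<open>a t\<close> only for
        \<open>2 \<le> t \<le> n\<close>, so \<open>k \<le> n\<close> ensures that no summand is
        lost.\<close>
      also have "\<dots> = (\<Sum>t\<le>k. coeff (curve n a i) t * Lpoly a d (k - t) ?\<beta>)"
        using False assms(2) by (intro sum.mono_neutral_cong_left) (auto simp: coeff_curve)
      finally show ?thesis .
    qed
  qed
qed

text \<open>Both sides obey the same recursion: splitting one factor \<open>curve n a i\<close> off
  the monomial gives the convolution of \<open>Lpoly_rec\<close>, and the factorials account for the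
  division by \<open>\<beta> i\<close>. The index \<open>i\<close> is the least one with a nonzero
  entry.\<close>

lemma Lpoly_eq_coeff:
  fixes a :: "nat \<Rightarrow> nat \<Rightarrow> 'a::field_char_0"
  assumes "k \<le> n" "0 < d"
  shows "Lpoly a d k \<beta> = (if \<forall>i\<ge>d. \<beta> i = 0
    then coeff (curve_monom d n a \<beta>) k / (\<Prod>i<d. fact (\<beta> i)) else 0)"
  using assms(1)
proof (induction k arbitrary: \<beta> rule: less_induct)
  case (less k)
  show ?case
  proof (cases "\<beta> = (\<lambda>_. 0)")
    case True
    then show ?thesis
      by (cases "k = 0") (simp_all add: Lpoly_0 Lpoly_at_0 mp_one_def curve_monom_def)
  next
    case False
    define i where "i = (LEAST i. \<beta> i \<noteq> 0)"
    have ex: "\<exists>i. \<beta> i \<noteq> 0" using False by auto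
    have i: "0 < \<beta> i" "\<And>j. j < i \<Longrightarrow> \<beta> j = 0"
      using LeastI_ex[OF ex] not_less_Least unfolding i_def by blast+
    let ?\<beta> = "\<beta>(i := \<beta> i - 1)"
    show ?thesis
    proof (cases "i < d")
      case False
      then have "\<not> (\<forall>i\<ge>d. \<beta> i = 0)" using i(1) by (metis not_less less_irrefl)
      then show ?thesis
        using Lpoly_rec[of k n \<beta> i d a] i less.prems assms(2) False
        by (cases "k = 0") (auto simp: Lpoly_0 mp_one_def)
    next
      case True
      have supp: "(\<forall>j\<ge>d. ?\<beta> j = 0) \<longleftrightarrow> (\<forall>j\<ge>d. \<beta> j = 0)" using True by auto
      have facts: "(\<Prod>j<d. fact (\<beta> j)) = of_nat (\<beta> i) * (\<Prod>j<d. fact (?\<beta> j) :: 'a)"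
      proof -
        have "(\<Prod>j<d. fact (\<beta> j)) = fact (\<beta> i) * (\<Prod>j\<in>{..<d} - {i}. fact (\<beta> j) :: 'a)"
          using True by (subst prod.remove[of _ i]) auto
        moreover have "(\<Prod>j<d. fact (?\<beta> j)) = fact (\<beta> i - 1) * (\<Prod>j\<in>{..<d} - {i}. fact (\<beta> j) :: 'a)"
          using True by (subst prod.remove[of _ i]) auto
        ultimately show ?thesis using i(1) by (simp add: fact_reduce mult_ac)
      qed
      have c: "coeff (curve_monom d n a \<beta>) k
          = (\<Sum>t\<le>k. coeff (curve n a i) t * coeff (curve_monom d n a ?\<beta>) (k - t))"
        by (simp add: curve_monom_split[where i = i, OF True] i(1) coeff_mult)
      show ?thesis
      proof (cases "k = 0")
        case True
        then show ?thesis using c False by (simp add: Lpoly_0 mp_one_def coeff_curve)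
      next
        case k: False
        have "Lpoly a d k \<beta> = (\<Sum>t\<le>k. coeff (curve n a i) t * Lpoly a d (k - t) ?\<beta>) / of_nat (\<beta> i)"
          using Lpoly_rec[of k n \<beta> i d a] i less.prems assms(2) True k by simp
        also have "\<dots> = (\<Sum>t\<le>k. coeff (curve n a i) t * (if \<forall>i\<ge>d. \<beta> i = 0
              then coeff (curve_monom d n a ?\<beta>) (k - t) / (\<Prod>j<d. fact (?\<beta> j)) else 0)) / of_nat (\<beta> i)"
        proof (intro arg_cong2[where f = "(/)"] sum.cong refl)
          fix t assume "t \<in> {..k}"
          show "coeff (curve n a i) t * Lpoly a d (k - t) ?\<beta> = coeff (curve n a i) t *
             (if \<forall>i\<ge>d. \<beta> i = 0 then coeff (curve_monom d n a ?\<beta>) (k - t) / (\<Prod>j<d. fact (?\<beta> j)) else 0)"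
          \<comment> \<open>The summand \<open>t = 0\<close> involves degree \<open>k\<close>
            itself, out of reach of the induction hypothesis, but the curve has no constant
            term.\<close>
          proof (cases "t = 0")
            case True
            then show ?thesis by (simp add: coeff_curve)
          next
            case False
            then have "k - t < k" "k - t \<le> n" using k less.prems by auto
            from less.IH[OF this] show ?thesis by (simp only: supp)
          qed
        qed
        also have "\<dots> = (if \<forall>i\<ge>d. \<beta> i = 0
            then coeff (curve_monom d n a \<beta>) k / (\<Prod>i<d. fact (\<beta> i)) else 0)"
        proof (cases "\<forall>i\<ge>d. \<beta> i = 0")
          case True
          then show ?thesis unfolding c facts by (simp add: sum_divide_distrib mult_ac)
        next
          case False
          show ?thesis by (simp only: False if_False mult_zero_right sum.neutral_const div_0)
        qed
        finally show ?thesis .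
      qed
    qed
  qed
qed

section \<open>Infinite sums: absolute convergence and grouping\<close>

text \<open>In finite dimension it suffices to look at the coordinates, which are real families, and
  to bound the norm by the sum of their absolute values.\<close>

lemma summable_on_imp_abs_summable_on:
  fixes f :: "'b \<Rightarrow> 'a::euclidean_space"
  assumes "f summable_on A"
  shows "(\<lambda>x. norm (f x)) summable_on A"
proof (rule Infinite_Sum.abs_summable_on_comparison_test')
  have *: "(\<lambda>x. \<bar>f x \<bullet> b\<bar>) summable_on A" for b
    using summable_on_bounded_linear[OF bounded_linear_inner_left assms]
      summable_on_iff_abs_summable_on_real by force
  have "(\<lambda>x. \<Sum>b\<in>B. \<bar>f x \<bullet> b\<bar>) summable_on A" if "finite B" for B
    using that by (induction B rule: finite_induct) (auto intro: summable_on_add *)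
  then show "(\<lambda>x. \<Sum>b\<in>Basis. \<bar>f x \<bullet> b\<bar>) summable_on A" by simp
qed (rule norm_le_l1)

text \<open>Used with \<open>g\<close> the exponent of one variable, to collect a multivariate
  series by powers of that variable.\<close>

lemma has_sum_partition:
  fixes f :: "'b \<Rightarrow> 'a::banach"
  assumes "(f has_sum s) A"
  shows "((\<lambda>m. infsum f {x \<in> A. g x = m}) has_sum s) UNIV"
proof (rule has_sum_SigmaD)
  show "((\<lambda>(m, x). f x) has_sum s) (SIGMA m:UNIV. {x \<in> A. g x = m})"
    using assms by (subst has_sum_reindex_bij_witness[where i = "\<lambda>x. (g x, x)" and j = snd and T = A]) auto
  show "((\<lambda>x. case (m, x) of (m, x) \<Rightarrow> f x) has_sum infsum f {x \<in> A. g x = m}) {x \<in> A. g x = m}" for m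
    using summable_on_subset_banach[OF has_sum_imp_summable[OF assms], of "{x \<in> A. g x = m}"]
    by auto
qed

section \<open>Partial derivatives of a power series at its centre\<close>

text \<open>The two derivative predicates coincide, so the equation also holds where no derivative
  exists.\<close>

lemma deriv_shift: "deriv F t = deriv (\<lambda>s. F (t + s)) 0"
  unfolding deriv_def DERIV_shift[of F _ 0 t, simplified] by (simp add: add.commute)

text \<open>Formulated along the whole line, not only at \<open>t = 0\<close>, because the induction
  step differentiates in \<open>t\<close>.\<close>

lemma funpow_pdiff:
  "(pdiff k ^^ m) g (z(k := z k + t)) = (deriv ^^ m) (\<lambda>t. g (z(k := z k + t))) t"
proof (induction m arbitrary: t)
  case (Suc m)
  have "(pdiff k ^^ Suc m) g (z(k := z k + t))
      = deriv (\<lambda>s. (pdiff k ^^ m) g (z(k := z k + (t + s)))) 0"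
    by (simp add: pdiff_def[of k "(pdiff k ^^ m) g"] add.assoc)
  also have "\<dots> = (deriv ^^ Suc m) (\<lambda>t. g (z(k := z k + t))) t"
    by (simp only: Suc.IH deriv_shift[of _ t] funpow.simps o_apply)
  finally show ?case .
qed simp

text \<open>Differentiation commutes with passing to the formal power series, whose
  \<open>m\<close>-th derivative has constant term \<open>fact m * b m\<close>.\<close>

lemma funpow_deriv_at_0:
  fixes F :: "'a::{real_normed_field,banach} \<Rightarrow> 'a"
  assumes "0 < r" "\<And>w. norm w < r \<Longrightarrow> (\<lambda>m. b m * w ^ m) sums F w"
  shows "(deriv ^^ m) F 0 = fact m * b m"
proof -
  have "\<forall>\<^sub>F w in nhds 0. norm (w :: 'a) < r"
    using eventually_nhds_ball[OF assms(1), of "0 :: 'a"] by simp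
  then have "F has_fps_expansion Abs_fps b"
    by (intro has_fps_expansionI, elim eventually_mono) (simp add: assms(2))
  then have "(deriv ^^ m) F has_fps_expansion (fps_deriv ^^ m) (Abs_fps b)"
    by (induction m) (auto intro: has_fps_expansion_deriv)
  then have "(deriv ^^ m) F 0 = fps_nth ((fps_deriv ^^ m) (Abs_fps b)) 0"
    by (auto simp: has_fps_expansion_def eval_fps_at_0 dest!: eventually_nhds_x_imp_x)
  then show ?thesis
    by (simp add: fps_0th_higher_deriv)
qed

text \<open>Since \<open>dpow\<close> differentiates with respect to the variables in order, the first \<open>k\<close> of them can be
  frozen at \<open>z0\<close> as soon as they are done with, so that only one-variable power series have
  to be differentiated, and only at their centre.\<close>

lemma dpow_has_sum:
  fixes f :: "(nat \<Rightarrow> 'a::{real_normed_field,banach}) \<Rightarrow> 'a"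
  assumes r: "0 < r"
    and f: "\<And>z. (\<forall>i\<ge>d. z i = 0) \<Longrightarrow> (\<forall>i<d. norm (z i - z0 i) < r) \<Longrightarrow>
       ((\<lambda>\<beta>. c \<beta> * (\<Prod>i<d. (z i - z0 i) ^ \<beta> i)) has_sum f z) {\<beta>. \<forall>i\<ge>d. \<beta> i = 0}"
    and "k \<le> d" "\<forall>i\<ge>d. z i = 0" "\<forall>i<d. norm (z i - z0 i) < r" "\<forall>i<k. z i = z0 i"
  shows "((\<lambda>\<beta>. (\<Prod>i<k. fact (\<alpha> i)) * (c \<beta> * (\<Prod>i\<in>{k..<d}. (z i - z0 i) ^ \<beta> i))) has_sum
      dpow k \<alpha> f z) {\<beta>. (\<forall>i\<ge>d. \<beta> i = 0) \<and> (\<forall>i<k. \<beta> i = \<alpha> i)}"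
  using assms(3-)
proof (induction k arbitrary: z)
  case 0
  then show ?case using f[of z] by (simp add: lessThan_atLeast0)
next
  case (Suc k)
  define A where "A = {\<beta>. (\<forall>i\<ge>d. \<beta> i = (0::nat)) \<and> (\<forall>i<k. \<beta> i = \<alpha> i)}"
  define B where "B m = {\<beta> \<in> A. \<beta> k = m}" for m
  \<comment> \<open>\<open>u\<close> drops the factor of variable \<open>k\<close>, while
    \<open>F\<close> lets that variable move. Grouping by its exponent gives \<open>F\<close> the
    one-variable expansion with coefficients \<open>b\<close>.\<close>
  define u where "u \<beta> = (\<Prod>i<k. fact (\<alpha> i)) * (c \<beta> * (\<Prod>i\<in>{Suc k..<d}. (z i - z0 i) ^ \<beta> i))" for \<beta>
  define F where "F t = dpow k \<alpha> f (z(k := z k + t))" for t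
  define b where "b m = infsum u (B m)" for m
  have k: "k < d" "z k = z0 k" using Suc.prems by auto
  have F: "((\<lambda>\<beta>. u \<beta> * w ^ \<beta> k) has_sum F w) A" if "norm w < r" for w
  proof -
    have "(\<Prod>i\<in>{k..<d}. ((z(k := z k + w)) i - z0 i) ^ \<beta> i)
        = w ^ \<beta> k * (\<Prod>i\<in>{Suc k..<d}. (z i - z0 i) ^ \<beta> i)" for \<beta>
      using k by (simp add: prod.atLeast_Suc_lessThan)
    then have "u \<beta> * w ^ \<beta> k
        = (\<Prod>i<k. fact (\<alpha> i)) * (c \<beta> * (\<Prod>i\<in>{k..<d}. ((z(k := z k + w)) i - z0 i) ^ \<beta> i))" for \<beta>
      by (simp add: u_def mult_ac)
    then show ?thesis
      unfolding F_def A_def using Suc.prems k that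
      by (simp only:) (intro Suc.IH, auto)
  qed
  have sub: "B m \<subseteq> A" for m by (auto simp: B_def)
  have u: "u summable_on B m" for m
  proof -
    \<comment> \<open>Any nonzero point of the disc would do: on \<open>B m\<close> the factor
      \<open>w ^ m\<close> is constant and can be divided out.\<close>
    define w :: 'a where "w = of_real (r / 2)"
    have "norm w < r" "w \<noteq> 0" using r by (auto simp: w_def)
    have "(\<lambda>\<beta>. u \<beta> * w ^ \<beta> k) summable_on B m"
      using summable_on_subset_banach[OF has_sum_imp_summable[OF F] sub] \<open>norm w < r\<close> by blast
    then have "(\<lambda>\<beta>. u \<beta> * w ^ \<beta> k * inverse (w ^ m)) summable_on B m"
      by (rule summable_on_cmult_left)
    then show ?thesis
      by (rule summable_on_cong[THEN iffD1, rotated]) (use \<open>w \<noteq> 0\<close> in \<open>auto simp: B_def\<close>)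
  qed
  have "(\<lambda>m. b m * w ^ m) sums F w" if "norm w < r" for w
  proof -
    have "infsum (\<lambda>\<beta>. u \<beta> * w ^ \<beta> k) (B m) = b m * w ^ m" for m
    proof -
      have "infsum (\<lambda>\<beta>. u \<beta> * w ^ \<beta> k) (B m) = infsum (\<lambda>\<beta>. u \<beta> * w ^ m) (B m)"
        by (intro infsum_cong) (simp add: B_def)
      then show ?thesis
        using infsum_cmult_left[OF u] by (simp add: b_def)
    qed
    then show ?thesis
      using has_sum_imp_sums[OF has_sum_partition[OF F[OF that], of "\<lambda>\<beta>. \<beta> k"]]
      by (simp add: B_def)
  qed
  then have "(deriv ^^ \<alpha> k) F 0 = fact (\<alpha> k) * b (\<alpha> k)"
    using r by (intro funpow_deriv_at_0) auto
  then have D: "dpow (Suc k) \<alpha> f z = fact (\<alpha> k) * b (\<alpha> k)"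
    using funpow_pdiff[where k = k and m = "\<alpha> k" and g = "dpow k \<alpha> f" and z = z and t = 0] by (simp add: F_def[abs_def])
  have "((\<lambda>\<beta>. fact (\<alpha> k) * u \<beta>) has_sum fact (\<alpha> k) * b (\<alpha> k)) (B (\<alpha> k))"
    unfolding b_def by (intro has_sum_cmult_right has_sum_infsum u)
  moreover have "B (\<alpha> k) = {\<beta>. (\<forall>i\<ge>d. \<beta> i = 0) \<and> (\<forall>i<Suc k. \<beta> i = \<alpha> i)}"
    by (auto simp: B_def A_def less_Suc_eq)
  ultimately show ?case
    unfolding D by (simp add: u_def mult_ac)
qed

text \<open>The case \<open>k = d\<close> of \<open>dpow_has_sum\<close>: with every exponent
  prescribed, only the index \<alpha> remains.\<close>

lemma partial_at_centre:
  fixes f :: "(nat \<Rightarrow> 'a::{real_normed_field,banach}) \<Rightarrow> 'a"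
  assumes "0 < r"
    and "\<And>z. (\<forall>i\<ge>d. z i = 0) \<Longrightarrow> (\<forall>i<d. norm (z i - z0 i) < r) \<Longrightarrow>
       ((\<lambda>\<beta>. c \<beta> * (\<Prod>i<d. (z i - z0 i) ^ \<beta> i)) has_sum f z) {\<beta>. \<forall>i\<ge>d. \<beta> i = 0}"
    and "\<forall>i\<ge>d. z0 i = 0" "\<forall>i\<ge>d. \<alpha> i = 0"
  shows "partial d \<alpha> f z0 = (\<Prod>i<d. fact (\<alpha> i)) * c \<alpha>"
proof -
  have "((\<lambda>\<beta>. (\<Prod>i<d. fact (\<alpha> i)) * (c \<beta> * (\<Prod>i\<in>{d..<d}. (z0 i - z0 i) ^ \<beta> i))) has_sum
      dpow d \<alpha> f z0) {\<beta>. (\<forall>i\<ge>d. \<beta> i = 0) \<and> (\<forall>i<d. \<beta> i = \<alpha> i)}"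
    by (rule dpow_has_sum[OF assms(1,2)]) (use assms in auto)
  moreover have "{\<beta>. (\<forall>i\<ge>d. \<beta> i = 0) \<and> (\<forall>i<d. \<beta> i = \<alpha> i)} = {\<alpha>}"
    using assms(4) by (auto simp: fun_eq_iff) (metis not_less)
  ultimately show ?thesis
    using has_sum_unique[OF _ has_sum_finite[of "{\<alpha>}"]] by (simp add: partial_def) blast
qed

section \<open>Tails of multivariate power series\<close>

text \<open>Comparing \<open>v\<close> with the point all of whose coordinates are \<open>\<rho>\<close> gains a factor
  \<open>(s / \<rho>) ^ N\<close> on every term of total degree at least \<open>N\<close>.\<close>

lemma power_series_remainder:
  fixes c :: "(nat \<Rightarrow> nat) \<Rightarrow> 'a::{real_normed_field,euclidean_space}"
  assumes "0 < \<rho>" "(\<lambda>\<beta>. c \<beta> * (\<Prod>i<d. of_real \<rho> ^ \<beta> i)) summable_on X"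
    and "\<And>\<beta>. \<beta> \<in> X \<Longrightarrow> N \<le> (\<Sum>i<d. \<beta> i)"
  obtains C where
    "\<forall>v s S. (\<forall>i<d. norm (v i) \<le> s) \<and> 0 \<le> s \<and> s \<le> \<rho> \<and>
       ((\<lambda>\<beta>. c \<beta> * (\<Prod>i<d. v i ^ \<beta> i)) has_sum S) X \<longrightarrow> norm S \<le> C * s ^ N"
proof -
  define M where "M = (\<lambda>\<beta>. norm (c \<beta> * (\<Prod>i<d. of_real \<rho> ^ \<beta> i)))"
  have M: "M summable_on X"
    unfolding M_def by (rule summable_on_imp_abs_summable_on[OF assms(2)])
  have Meq: "M \<beta> = norm (c \<beta>) * \<rho> ^ (\<Sum>i<d. \<beta> i)" for \<beta>
    using assms(1) by (simp add: M_def norm_mult power_sum norm_power flip: prod_norm)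
  show thesis
  proof (rule that[of "infsum M X / \<rho> ^ N"], intro allI impI, elim conjE)
    fix v :: "nat \<Rightarrow> 'a" and s S
    assume *: "\<forall>i<d. norm (v i) \<le> s" "0 \<le> s" "s \<le> \<rho>"
      "((\<lambda>\<beta>. c \<beta> * (\<Prod>i<d. v i ^ \<beta> i)) has_sum S) X"
    have "norm S \<le> infsum M X * (s / \<rho>) ^ N"
    proof (rule norm_infsum_le[OF *(4)])
      show "((\<lambda>\<beta>. M \<beta> * (s / \<rho>) ^ N) has_sum infsum M X * (s / \<rho>) ^ N) X"
        by (intro has_sum_cmult_left has_sum_infsum M)
      fix \<beta> assume "\<beta> \<in> X"
      let ?n = "\<Sum>i<d. \<beta> i"
      have "norm (\<Prod>i<d. v i ^ \<beta> i) \<le> (\<Prod>i<d. s ^ \<beta> i)"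
        unfolding prod_norm[symmetric] using *(1) by (intro prod_mono) (auto simp: norm_power power_mono)
      then have "norm (c \<beta> * (\<Prod>i<d. v i ^ \<beta> i)) \<le> norm (c \<beta>) * s ^ ?n"
        by (simp add: norm_mult power_sum mult_left_mono)
      also have "s ^ ?n = \<rho> ^ ?n * (s / \<rho>) ^ ?n"
        using assms(1) by (simp add: power_divide)
      also have "(s / \<rho>) ^ ?n \<le> (s / \<rho>) ^ N"
        using *(2,3) assms(1) assms(3)[OF \<open>\<beta> \<in> X\<close>] by (intro power_decreasing) auto
      finally show "norm (c \<beta> * (\<Prod>i<d. v i ^ \<beta> i)) \<le> M \<beta> * (s / \<rho>) ^ N"
        using assms(1) by (simp add: Meq mult.assoc mult_left_mono)
    qed
    then show "norm S \<le> infsum M X / \<rho> ^ N * s ^ N"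
      by (simp add: power_divide)
  qed
qed

section \<open>The limit of scaled divided differences\<close>

text \<open>On \<open>p\<close> the weighted sum is a polynomial \<open>Q\<close> in
  \<open>h\<close>, and the moment identity removes its terms below \<open>h ^ m\<close>, leaving
  \<open>coeff p m\<close> as the leading one. The error \<open>g - p\<close> has order
  \<open>m + 1\<close> and contributes a multiple of \<open>norm h\<close> after division by
  \<open>h ^ m\<close>.\<close>

lemma tendsto_scaled_sum_poly:
  fixes g :: "'a::real_normed_field \<Rightarrow> 'a"
  assumes "0 < \<delta>" "\<And>t. norm t < \<delta> \<Longrightarrow> norm (g t - poly p t) \<le> C * norm t ^ Suc m"
  shows "((\<lambda>h. 1 / h ^ m * (\<Sum>r=0..m. Acoef m r * g (of_nat r * h))) \<longlongrightarrow> coeff p m) (at 0)"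
proof -
  define Q where "Q = (\<Sum>r=0..m. smult (Acoef m r) (pcompose p [:0, of_nat r:]))"
  define K where "K = (\<Sum>r=0..m. norm (Acoef m r :: 'a) * (C * real r ^ Suc m))"
  have poly_Q: "poly Q h = (\<Sum>r=0..m. Acoef m r * poly p (of_nat r * h))" for h
    by (simp add: Q_def poly_sum poly_pcompose mult.commute)
  have "coeff Q k = (\<Sum>r=0..m. Acoef m r * of_nat r ^ k) * coeff p k" for k
    by (simp add: Q_def coeff_sum coeff_pcompose_linear sum_distrib_right mult.assoc)
  then have coeff_Q: "coeff Q k = (if k = m then coeff p m else 0)" if "k \<le> m" for k
    using that by (simp add: sum_Acoef_power)
  then have "monom 1 m dvd Q"
    by (simp add: monom_1_dvd_iff')
  then obtain q where q: "Q = monom 1 m * q" by (elim dvdE)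
  have "(poly q \<longlongrightarrow> poly q 0) (at 0)"
    by (intro isContD) simp
  also have "poly q 0 = coeff p m"
    using coeff_Q[of m] by (simp add: q coeff_monom_mult poly_0_coeff_0)
  finally have lim_q: "(poly q \<longlongrightarrow> coeff p m) (at 0)" .
  have "((\<lambda>h. 1 / h ^ m * (\<Sum>r=0..m. Acoef m r * g (of_nat r * h)) - poly q h) \<longlongrightarrow> 0) (at 0)"
  proof (rule Lim_null_comparison)
    show "((\<lambda>h :: 'a. K * norm h) \<longlongrightarrow> 0) (at 0)"
      by (rule tendsto_eq_intros | simp)+
    \<comment> \<open>Division by \<open>Suc m\<close> keeps all the points
      \<open>of_nat r * h\<close> with \<open>r \<le> m\<close> inside the ball of radius
      \<delta>.\<close>
    have "\<forall>\<^sub>F h in at 0. norm (h :: 'a) < \<delta> / Suc m \<and> h \<noteq> 0"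
      using assms(1) by (auto simp: eventually_at intro!: exI[of _ "\<delta> / Suc m"])
    then show "\<forall>\<^sub>F h in at 0. norm (1 / h ^ m * (\<Sum>r=0..m. Acoef m r * g (of_nat r * h))
        - poly q h) \<le> K * norm h"
    proof eventually_elim
      fix h :: 'a assume h: "norm h < \<delta> / Suc m \<and> h \<noteq> 0"
      have "norm (Acoef m r * (g (of_nat r * h) - poly p (of_nat r * h)))
          \<le> norm (Acoef m r :: 'a) * (C * real r ^ Suc m) * norm h ^ Suc m" if "r \<le> m" for r
      proof -
        have "real r * norm h \<le> Suc m * norm h"
          using that by (intro mult_right_mono) auto
        also have "\<dots> < \<delta>" using h by (simp add: field_simps)
        finally have "norm (of_nat r * h) < \<delta>" by (simp add: norm_mult)
        from mult_left_mono[OF assms(2)[OF this] norm_ge_zero[of "Acoef m r :: 'a"]]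
        show ?thesis by (simp add: norm_mult power_mult_distrib mult_ac)
      qed
      then have "norm (\<Sum>r=0..m. Acoef m r * (g (of_nat r * h) - poly p (of_nat r * h)))
          \<le> (\<Sum>r=0..m. norm (Acoef m r :: 'a) * (C * real r ^ Suc m) * norm h ^ Suc m)"
        by (intro sum_norm_le) simp
      also have "\<dots> = K * norm h * norm h ^ m"
        by (simp add: K_def sum_distrib_left sum_distrib_right mult_ac)
      also have "(\<Sum>r=0..m. Acoef m r * (g (of_nat r * h) - poly p (of_nat r * h)))
          = (1 / h ^ m * (\<Sum>r=0..m. Acoef m r * g (of_nat r * h)) - poly q h) * h ^ m"
        using h poly_Q[of h] by (simp add: q poly_monom right_diff_distrib sum_subtractf field_simps)
      finally show "norm (1 / h ^ m * (\<Sum>r=0..m. Acoef m r * g (of_nat r * h)) - poly q h)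
          \<le> K * norm h"
        using h by (simp add: norm_mult norm_power)
    qed
  qed
  from tendsto_add[OF this lim_q] show ?thesis by simp
qed

section \<open>The limit along the curve\<close>

lemma norm_poly_le_norm:
  fixes t :: "'a::real_normed_field"
  assumes "coeff p 0 = 0" "norm t \<le> 1"
  shows "norm (poly p t) \<le> (\<Sum>j\<le>degree p. norm (coeff p j)) * norm t"
  unfolding poly_altdef sum_distrib_right
proof (rule sum_norm_le)
  fix j
  show "norm (coeff p j * t ^ j) \<le> norm (coeff p j) * norm t"
  proof (cases j)
    case (Suc i)
    have "norm t ^ j \<le> norm t" 
      using assms(2) power_decreasing[of 1 j "norm t"] Suc by simp
    then show ?thesis by (simp add: norm_mult norm_power mult_left_mono)
  qed (simp add: assms(1))
qed

text \<open>The type class covers both the reals and the complex numbers, so one argument serves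
  both fields.\<close>

lemma tendsto_polyD_Lpoly:
  fixes f :: "(nat \<Rightarrow> 'a::{real_normed_field,euclidean_space}) \<Rightarrow> 'a"
  assumes "0 < d" "m \<le> n" and z0: "\<forall>i\<ge>d. z0 i = 0" and "analytic_pt d f z0"
  shows "((\<lambda>h. (1 / h ^ m) * (\<Sum>r=0..m. Acoef m r * f (znode d n a z0 r h)))
    \<longlongrightarrow> polyD d (Lpoly a d m) f z0) (at 0)"
proof -
  obtain r c where r: "0 < r" and f: "\<And>z. (\<forall>i\<ge>d. z i = 0) \<Longrightarrow> (\<forall>i<d. norm (z i - z0 i) < r) \<Longrightarrow>
      ((\<lambda>\<beta>. c \<beta> * (\<Prod>i<d. (z i - z0 i) ^ \<beta> i)) has_sum f z) {\<beta>. \<forall>i\<ge>d. \<beta> i = 0}"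
    using assms(4) unfolding analytic_pt_def by blast
  define X where "X = {\<beta>. (\<forall>i\<ge>d. \<beta> i = 0) \<and> Suc m \<le> (\<Sum>i<d. \<beta> i)}"
  define S where "S = {\<beta>. (\<forall>i\<ge>d. \<beta> i = 0) \<and> (\<Sum>i<d. \<beta> i) \<le> m}"
  have "S \<subseteq> {\<beta>. \<forall>i. (i \<in> {..<d} \<longrightarrow> \<beta> i \<in> {..m}) \<and> (i \<notin> {..<d} \<longrightarrow> \<beta> i = 0)}"
  proof (intro subsetI CollectI allI conjI impI)
    fix \<beta> i assume \<beta>: "\<beta> \<in> S"
    show "\<beta> i = 0" if "i \<notin> {..<d}" using \<beta> that by (simp add: S_def)
    show "\<beta> i \<in> {..m}" if "i \<in> {..<d}"
      using \<beta> member_le_sum[OF that, of \<beta>] by (simp add: S_def)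
  qed
  then have fin: "finite S"
    by (rule finite_subset) (intro finite_set_of_finite_funs, auto)
  \<comment> \<open>The Taylor polynomial of \<open>f\<close> of total degree at most
    \<open>m\<close>, composed with the curve. Its degree in \<open>t\<close> may exceed
    \<open>m\<close>; what counts is that the error has order \<open>m + 1\<close>.\<close>
  define p where "p = (\<Sum>\<beta>\<in>S. smult (c \<beta>) (curve_monom d n a \<beta>))"

  \<comment> \<open>The factorials in the partial derivatives cancel the denominators in
    \<open>Lpoly_eq_coeff\<close>.\<close>
  have "coeff p m = polyD d (Lpoly a d m) f z0"
    unfolding polyD_def p_def coeff_sum coeff_smult
  proof (rule sum.mono_neutral_cong_right[OF fin])
    show "{\<alpha>. Lpoly a d m \<alpha> \<noteq> 0} \<subseteq> S"
    proof
      fix \<alpha> assume "\<alpha> \<in> {\<alpha>. Lpoly a d m \<alpha> \<noteq> 0}"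
      then show "\<alpha> \<in> S"
        using coeff_curve_monom_eq_0[of m \<alpha> d n a] leI
        by (auto simp: S_def Lpoly_eq_coeff[OF assms(2,1)] split: if_splits)
    qed
    have *: "Lpoly a d m \<alpha> = coeff (curve_monom d n a \<alpha>) m / (\<Prod>i<d. fact (\<alpha> i))" if "\<alpha> \<in> S" for \<alpha>
      using that by (simp add: S_def Lpoly_eq_coeff[OF assms(2,1)])
    show "\<forall>\<alpha>\<in>S - {\<alpha>. Lpoly a d m \<alpha> \<noteq> 0}. c \<alpha> * coeff (curve_monom d n a \<alpha>) m = 0"
    proof
      fix \<alpha> assume "\<alpha> \<in> S - {\<alpha>. Lpoly a d m \<alpha> \<noteq> 0}"
      then show "c \<alpha> * coeff (curve_monom d n a \<alpha>) m = 0" using *[of \<alpha>] by auto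
    qed
    fix \<alpha> assume "\<alpha> \<in> {\<alpha>. Lpoly a d m \<alpha> \<noteq> 0}"
    then have "\<alpha> \<in> S" using \<open>_ \<subseteq> S\<close> by blast
    then show "c \<alpha> * coeff (curve_monom d n a \<alpha>) m = Lpoly a d m \<alpha> * partial d \<alpha> f z0"
      using partial_at_centre[OF r f z0, of \<alpha>] *[of \<alpha>] by (simp add: S_def)
  qed

  define z where "z t = (\<lambda>i. z0 i + (if i < d then poly (curve n a i) t else 0))" for t
  have node: "znode d n a z0 r h = z (of_nat r * h)" for r h
    using assms(1) by (auto simp: znode_def z_def curve_def poly_sum poly_monom fun_eq_iff)

  define K where "K = (\<Sum>i<d. \<Sum>j\<le>degree (curve n a i). norm (coeff (curve n a i) j))"
  have K: "norm (poly (curve n a i) t) \<le> K * norm t" if "i < d" "norm t \<le> 1" for i t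
  proof -
    have "norm (poly (curve n a i) t)
        \<le> (\<Sum>j\<le>degree (curve n a i). norm (coeff (curve n a i) j)) * norm t"
      using that by (intro norm_poly_le_norm) (auto simp: coeff_curve)
    also have "\<dots> \<le> K * norm t"
      unfolding K_def using that
      by (intro mult_right_mono member_le_sum[where f = "\<lambda>i. \<Sum>j\<le>degree (curve n a i). norm (coeff (curve n a i) j)"])
        (auto intro: sum_nonneg)
    finally show ?thesis .
  qed
  have "0 \<le> K" by (simp add: K_def sum_nonneg)

  \<comment> \<open>Strictly below \<open>r\<close>, so that the series converges at the point
    shifted by \<rho> in every coordinate; its terms there dominate the tail.\<close>
  define \<rho> where "\<rho> = r / 2"
  have \<rho>: "0 < \<rho>" "\<rho> < r" using r by (auto simp: \<rho>_def)
  have "(\<lambda>\<beta>. c \<beta> * (\<Prod>i<d. of_real \<rho> ^ \<beta> i)) summable_on X"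
  proof -
    have "((\<lambda>\<beta>. c \<beta> * (\<Prod>i<d. ((if i < d then z0 i + of_real \<rho> else 0) - z0 i) ^ \<beta> i)) has_sum
        f (\<lambda>i. if i < d then z0 i + of_real \<rho> else 0)) {\<beta>. \<forall>i\<ge>d. \<beta> i = 0}"
      using \<rho> by (intro f) auto
    from summable_on_subset_banach[OF has_sum_imp_summable[OF this], of X]
    show ?thesis by (simp add: X_def Collect_mono)
  qed
  moreover have "Suc m \<le> (\<Sum>i<d. \<beta> i)" if "\<beta> \<in> X" for \<beta>
    using that by (simp add: X_def)
  ultimately obtain C where C: "\<forall>v s S. (\<forall>i<d. norm (v i) \<le> s) \<and> 0 \<le> s \<and> s \<le> \<rho> \<and>
      ((\<lambda>\<beta>. c \<beta> * (\<Prod>i<d. v i ^ \<beta> i)) has_sum S) X \<longrightarrow> norm S \<le> C * s ^ Suc m"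
    by (rule power_series_remainder[OF \<rho>(1)])

  \<comment> \<open>The bound 1 is for the estimate \<open>K\<close>, the quotient gives
    \<open>K * norm t \<le> \<rho>\<close>; adding 1 makes the denominator positive from
    \<open>0 \<le> K\<close> alone.\<close>
  define \<delta> where "\<delta> = min 1 (\<rho> / (K + 1))"
  have "0 < \<delta>" using \<rho> \<open>0 \<le> K\<close> by (simp add: \<delta>_def)
  moreover have "norm (f (z t) - poly p t) \<le> (C * K ^ Suc m) * norm t ^ Suc m" if "norm t < \<delta>" for t
  proof -
    have t: "norm t \<le> 1" "norm t * (K + 1) < \<rho>"
      using that \<open>0 \<le> K\<close> by (auto simp: \<delta>_def pos_less_divide_eq)
    then have "K * norm t \<le> \<rho>" by (simp add: algebra_simps) (smt (verit) norm_ge_zero)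
    have le: "\<forall>i<d. norm (poly (curve n a i) t) \<le> K * norm t" using K t by blast
    have "((\<lambda>\<beta>. c \<beta> * (\<Prod>i<d. (z t i - z0 i) ^ \<beta> i)) has_sum f (z t)) {\<beta>. \<forall>i\<ge>d. \<beta> i = 0}"
    proof (rule f)
      show "\<forall>i\<ge>d. z t i = 0" using z0 by (simp add: z_def)
      show "\<forall>i<d. norm (z t i - z0 i) < r"
        using le \<open>K * norm t \<le> \<rho>\<close> \<rho>(2) by (auto simp: z_def intro: le_less_trans)
    qed
    then have "((\<lambda>\<beta>. c \<beta> * (\<Prod>i<d. poly (curve n a i) t ^ \<beta> i)) has_sum f (z t)) {\<beta>. \<forall>i\<ge>d. \<beta> i = 0}"
      by (simp add: z_def)
    moreover have "((\<lambda>\<beta>. c \<beta> * (\<Prod>i<d. poly (curve n a i) t ^ \<beta> i)) has_sum poly p t) S"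
      by (rule has_sum_finiteI[OF fin]) (simp add: p_def poly_sum curve_monom_def poly_prod)
    \<comment> \<open>Removing \<open>S\<close> leaves the tail of total degree above
      \<open>m\<close>, to which \<open>C\<close> applies with
      \<open>s = K * norm t\<close>.\<close>
    ultimately have "((\<lambda>\<beta>. c \<beta> * (\<Prod>i<d. poly (curve n a i) t ^ \<beta> i)) has_sum f (z t) - poly p t)
        ({\<beta>. \<forall>i\<ge>d. \<beta> i = 0} - S)"
      by (rule has_sum_Diff) (auto simp: S_def)
    also have "{\<beta>. \<forall>i\<ge>d. \<beta> i = 0} - S = X" by (auto simp: S_def X_def)
    finally have "norm (f (z t) - poly p t) \<le> C * (K * norm t) ^ Suc m"
      using le \<open>K * norm t \<le> \<rho>\<close> \<open>0 \<le> K\<close>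
      by (intro C[rule_format, of "\<lambda>i. poly (curve n a i) t"]) auto
    then show ?thesis by (simp add: power_mult_distrib mult_ac)
  qed
  ultimately have "((\<lambda>h. 1 / h ^ m * (\<Sum>r=0..m. Acoef m r * f (z (of_nat r * h)))) \<longlongrightarrow> coeff p m) (at 0)"
    by (rule tendsto_scaled_sum_poly[where g = "\<lambda>t. f (z t)"])
  then show ?thesis
    by (simp only: node \<open>coeff p m = _\<close>)
qed

theorem theorem9:
  shows "(\<forall>(d::nat) (n::nat) (a :: nat \<Rightarrow> nat \<Rightarrow> real) (z0 :: nat \<Rightarrow> real) f m.
            2 \<le> d \<and> 1 \<le> n \<and> m \<le> n \<and> (\<forall>i\<ge>d. z0 i = 0) \<and> analytic_pt d f z0 \<longrightarrow>
            ((\<lambda>h. (1 / h ^ m) * (\<Sum>r=0..m. Acoef m r * f (znode d n a z0 r h)))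
               \<longlongrightarrow> polyD d (Lpoly a d m) f z0) (at 0))
       \<and> (\<forall>(d::nat) (n::nat) (a :: nat \<Rightarrow> nat \<Rightarrow> complex) (z0 :: nat \<Rightarrow> complex) f m.
            2 \<le> d \<and> 1 \<le> n \<and> m \<le> n \<and> (\<forall>i\<ge>d. z0 i = 0) \<and> analytic_pt d f z0 \<longrightarrow>
            ((\<lambda>h. (1 / h ^ m) * (\<Sum>r=0..m. Acoef m r * f (znode d n a z0 r h)))
               \<longlongrightarrow> polyD d (Lpoly a d m) f z0) (at 0))"
  by (intro conjI allI impI; rule tendsto_polyD_Lpoly; simp)

end
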